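(* There exists a generically computable set $A \subseteq \omega$ of density $1$ such that no generic algorithm for $A$ has computable domain.
   Context: $\omega = \{0,1,2,\dots\}$. The density of $S \subseteq \omega$ is $\rho(S) = \lim_{n\to\infty} \frac{|S \cap [0,n]|}{n+1}$, when this limit exists. A generic description of $A$ is a partial function $\Phi$ from $\omega$ to $\{0,1\}$ such that $\Phi(x) = \chi_A(x)$ whenever $\Phi(x)$ is defined and the domain of $\Phi$ has density $1$; here $\chi_A$ is the characteristic function of $A$. A generic algorithm for $A$ is a partial computable function which is a generic description of $A$, and $A$ is generically computable if there is a generic algorithm for $A$. *)

theory Defs
  imports Complex_Main "HOL-Library.Indicator_Function"
begin

text \<open>
  Partial computability is Kleene's notion of partial recursive function. Schemes are untyped with
  respect to arity: a scheme denotes one partial function on tuples of each length, and is undefined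
  on tuples whose length does not fit. \<open>PrimRec\<close> recurses on the first argument, and \<open>Mu\<close> minimizes
  over the first argument.
\<close>

datatype recf =
    Zero
  | Succ
  | Proj nat
  | Comp recf "recf list"
  | PrimRec recf recf
  | Mu recf

inductive rec_eval :: "recf \<Rightarrow> nat list \<Rightarrow> nat \<Rightarrow> bool" where
  Zero: "rec_eval Zero xs 0"
| Succ: "rec_eval Succ [x] (Suc x)"
| Proj: "i < length xs \<Longrightarrow> rec_eval (Proj i) xs (xs ! i)"
| Comp: "list_all2 (\<lambda>g y. rec_eval g xs y) gs ys \<Longrightarrow> rec_eval f ys z
    \<Longrightarrow> rec_eval (Comp f gs) xs z"
| PrimRec_0: "rec_eval f xs y \<Longrightarrow> rec_eval (PrimRec f g) (0 # xs) y"
| PrimRec_Suc: "rec_eval (PrimRec f g) (n # xs) r \<Longrightarrow> rec_eval g (n # r # xs) y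
    \<Longrightarrow> rec_eval (PrimRec f g) (Suc n # xs) y"
| Mu: "rec_eval f (n # xs) 0 \<Longrightarrow> (\<forall>k<n. \<exists>y>0. rec_eval f (k # xs) y)
    \<Longrightarrow> rec_eval (Mu f) xs n"

lemma rec_eval_deterministic: "rec_eval f xs y \<Longrightarrow> rec_eval f xs z \<Longrightarrow> y = z"
proof (induction f xs y arbitrary: z rule: rec_eval.induct)
  case (Zero xs)
  then show ?case by cases simp
next
  case (Succ x)
  then show ?case by cases simp
next
  case (Proj i xs)
  from Proj.prems show ?case by cases simp
next
  case (Comp xs gs ys f w)
  from Comp.prems obtain ys' where
    ys': "list_all2 (\<lambda>g y. rec_eval g xs y) gs ys'" "rec_eval f ys' z"
    by cases auto
  have "ys = ys'"
    using Comp.IH(1) ys'(1) by (auto simp: list_all2_conv_all_nth intro!: nth_equalityI)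
  with ys'(2) Comp.IH(2) show ?case by simp
next
  case (PrimRec_0 f xs y g)
  from PrimRec_0.prems show ?case by cases (use PrimRec_0.IH in auto)
next
  case (PrimRec_Suc f g n xs r y)
  from PrimRec_Suc.prems show ?case
    by cases (use PrimRec_Suc.IH in blast)
next
  case (Mu f n xs)
  from Mu.prems show ?case
  proof cases
    case Mu': Mu
    have "\<not> z < n" using Mu.IH(2) Mu'(1) by fastforce
    moreover have "\<not> n < z" using Mu.IH(1) Mu'(2) by fastforce
    ultimately show ?thesis by simp
  qed
qed

definition partial_computable :: "(nat \<rightharpoonup> nat) \<Rightarrow> bool" where
  "partial_computable \<phi> \<longleftrightarrow> (\<exists>r. \<forall>x y. \<phi> x = Some y \<longleftrightarrow> rec_eval r [x] y)"

definition computable_set :: "nat set \<Rightarrow> bool" where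
  "computable_set S \<longleftrightarrow> partial_computable (\<lambda>x. Some (indicator S x))"

definition has_density :: "nat set \<Rightarrow> real \<Rightarrow> bool" where
  "has_density S d \<longleftrightarrow> (\<lambda>n. real (card (S \<inter> {0..n})) / real (n + 1)) \<longlonglongrightarrow> d"

definition generic_description :: "nat set \<Rightarrow> (nat \<rightharpoonup> nat) \<Rightarrow> bool" where
  "generic_description A \<Phi> \<longleftrightarrow>
     ran \<Phi> \<subseteq> {0, 1} \<and> (\<forall>x \<in> dom \<Phi>. \<Phi> x = Some (indicator A x)) \<and> has_density (dom \<Phi>) 1"

definition generic_algorithm :: "nat set \<Rightarrow> (nat \<rightharpoonup> nat) \<Rightarrow> bool" where
  "generic_algorithm A \<Phi> \<longleftrightarrow> partial_computable \<Phi> \<and> generic_description A \<Phi>"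

definition generically_computable :: "nat set \<Rightarrow> bool" where
  "generically_computable A \<longleftrightarrow> (\<exists>\<Phi>. generic_algorithm A \<Phi>)"

end

theory Submission
  imports Defs "HOL-Library.Nat_Bijection"
begin

text \<open>
  The set is built as a computably enumerable set, so that it is generically computable as soon as it
  has density \<open>1\<close>: answer \<open>1\<close> on its elements and diverge elsewhere. If some generic algorithm
  \<open>\<Phi>\<close> for a set \<open>A\<close> of density \<open>1\<close> has computable domain, then \<open>C = dom \<Phi> \<inter> A\<close> is
  computable, since on the decidable set \<open>dom \<Phi>\<close> membership in \<open>A\<close> is read off from \<open>\<Phi>\<close>, and it
  still has density \<open>1\<close>. So it suffices that \<open>A\<close> has no computable subset of density \<open>1\<close>.

  To achieve this, the positive numbers are split into the sets of numbers with exactly \<open>e\<close> factors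
  \<open>2\<close>, one for each program code \<open>e\<close>, and each of them is cut into blocks, the \<open>m\<close>-th one lying in
  \<open>{2 ^ m..<2 ^ (m + 1)}\<close>. At every stage exactly one block for each \<open>e\<close> is withheld from
  \<open>A\<close>. It is withheld until program \<open>e\<close> is seen to output \<open>0\<close> on all of it; then it is released,
  and a block beyond everything treated so far is withheld instead. The other blocks with an index
  up to the current stage are put into \<open>A\<close>. At most one block is withheld forever for each \<open>e\<close>,
  which leaves \<open>A\<close> with density \<open>1\<close> (\<open>has_density_released\<close>). Suppose that program \<open>e\<close> decides \<open>C \<subseteq> A\<close>. A block
  withheld forever is disjoint from \<open>A\<close>, hence from \<open>C\<close>, so the program outputs \<open>0\<close> on all of it
  and it would be released after all. Therefore infinitely many blocks are withheld and later released, and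
  on each of these the program outputs \<open>0\<close>, so \<open>C\<close> misses infinitely many blocks. As the \<open>m\<close>-th block takes up
  a proportion of about \<open>2 ^ -(e + 2)\<close> of the numbers below \<open>2 ^ (m + 1)\<close>, the set \<open>C\<close> does not
  have density \<open>1\<close> (\<open>released_no_computable_dense_subset\<close>).

  For \<open>A\<close> to be computably enumerable it must be decidable whether a program has been seen to produce
  an output within \<open>s\<close> stages. This takes the place of a universal machine: programs and lists are
  coded as numbers, a derivation of \<open>rec_eval\<close> becomes a list of claims each of which follows from the
  later list entries, and a stage bounds the code of a derivation. Being such a derivation is a
  property with bounded quantifiers only, so closure properties of the decidable relations show that
  it is decidable (\<open>decidable_verified\<close>) without a program for it being spelled out.
\<close>

section \<open>Total computable functions and decidable relations\<close>

definition total_computable :: "nat \<Rightarrow> (nat list \<Rightarrow> nat) \<Rightarrow> bool" where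
  "total_computable n f \<longleftrightarrow> (\<exists>r. \<forall>xs. length xs = n \<longrightarrow> rec_eval r xs (f xs))"

text \<open>
  Truth is reported as \<open>0\<close> because unbounded search stops at the first zero.
\<close>

definition decidable :: "nat \<Rightarrow> (nat list \<Rightarrow> bool) \<Rightarrow> bool" where
  "decidable n P \<longleftrightarrow> total_computable n (\<lambda>xs. if P xs then 0 else 1)"

text \<open>
  Closure properties are applied to terms over an environment list. Entering the scope of a
  quantifier, a recursion or a search puts the bound variable in front of the environment, so that
  occurrences of the outer environment turn into iterated tails of the new one. The predicate records
  that \<open>p\<close> is such an iterated tail, of length \<open>m\<close>.
\<close>

definition env_suffix :: "nat \<Rightarrow> nat \<Rightarrow> (nat list \<Rightarrow> nat list) \<Rightarrow> bool" where
  "env_suffix n m p \<longleftrightarrow> m \<le> n \<and> (\<forall>xs. length xs = n \<longrightarrow> p xs = drop (n - m) xs)"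

lemma env_suffix_self: "env_suffix n n (\<lambda>xs. xs)"
  by (simp add: env_suffix_def)

lemma env_suffix_tl: "env_suffix n (Suc m) p \<Longrightarrow> env_suffix n m (\<lambda>xs. tl (p xs))"
  by (auto simp: env_suffix_def tl_drop Suc_diff_Suc simp flip: drop_Suc)

lemma total_computable_nth:
  assumes "env_suffix n m p" "i < m"
  shows "total_computable n (\<lambda>xs. p xs ! i)"
  unfolding total_computable_def
proof (intro exI allI impI)
  fix xs :: "nat list"
  assume "length xs = n"
  with assms have "p xs ! i = xs ! (n - m + i)" "n - m + i < length xs"
    by (auto simp: env_suffix_def)
  then show "rec_eval (Proj (n - m + i)) xs (p xs ! i)"
    by (metis rec_eval.Proj)
qed

lemma total_computable_cong:
  assumes "total_computable n f" "\<And>xs. length xs = n \<Longrightarrow> f xs = g xs"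
  shows "total_computable n g"
  using assms unfolding total_computable_def by auto

lemma total_computable_compose:
  assumes f: "total_computable (length gs) f" and gs: "\<And>g. g \<in> set gs \<Longrightarrow> total_computable n g"
  shows "total_computable n (\<lambda>xs. f (map (\<lambda>g. g xs) gs))"
proof -
  obtain rf where rf: "\<And>xs. length xs = length gs \<Longrightarrow> rec_eval rf xs (f xs)"
    using f unfolding total_computable_def by blast
  obtain R where R: "\<And>g xs. g \<in> set gs \<Longrightarrow> length xs = n \<Longrightarrow> rec_eval (R g) xs (g xs)"
    using gs unfolding total_computable_def by metis
  have "rec_eval (Comp rf (map R gs)) xs (f (map (\<lambda>g. g xs) gs))" if "length xs = n" for xs
    using that by (intro rec_eval.Comp[OF _ rf]) (auto simp: list_all2_conv_all_nth R)
  then show ?thesis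
    unfolding total_computable_def by blast
qed

lemma total_computable_hd:
  assumes "env_suffix n (Suc m) p"
  shows "total_computable n (\<lambda>xs. hd (p xs))"
proof (rule total_computable_cong[OF total_computable_nth[OF assms zero_less_Suc]])
  fix xs :: "nat list"
  assume "length xs = n"
  with assms have "p xs \<noteq> []"
    by (auto simp: env_suffix_def)
  then show "p xs ! 0 = hd (p xs)"
    by (simp add: hd_conv_nth)
qed

lemma env_suffix_eq_map:
  assumes "env_suffix n m p" "length xs = n"
  shows "map (\<lambda>g. g xs) (map (\<lambda>i xs. p xs ! i) [0..<m]) = p xs"
  using assms by (auto simp: env_suffix_def list_eq_iff_nth_eq)

text \<open>
  Substitution for a bound variable, combined with weakening of the environment.
\<close>

lemma total_computable_bind:
  assumes f: "total_computable (Suc m) (\<lambda>ys. f (hd ys) (tl ys))" and a: "total_computable n a"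
    and p: "env_suffix n m p"
  shows "total_computable n (\<lambda>xs. f (a xs) (p xs))"
proof -
  let ?vars = "map (\<lambda>i xs. p xs ! i) [0..<m]"
  have "total_computable n (\<lambda>xs. f (hd (map (\<lambda>g. g xs) (a # ?vars)))
      (tl (map (\<lambda>g. g xs) (a # ?vars))))"
    using f a by (intro total_computable_compose) (auto intro: total_computable_nth[OF p])
  then show ?thesis
  proof (rule total_computable_cong)
    fix xs :: "nat list"
    assume "length xs = n"
    from env_suffix_eq_map[OF p this]
    show "f (hd (map (\<lambda>g. g xs) (a # ?vars))) (tl (map (\<lambda>g. g xs) (a # ?vars))) =
        f (a xs) (p xs)"
      by simp
  qed
qed

lemma total_computable_weaken:
  assumes f: "total_computable m f" and p: "env_suffix n m p"
  shows "total_computable n (\<lambda>xs. f (p xs))"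
proof -
  let ?vars = "map (\<lambda>i xs. p xs ! i) [0..<m]"
  have "total_computable n (\<lambda>xs. f (map (\<lambda>g. g xs) ?vars))"
    using f by (intro total_computable_compose) (auto intro: total_computable_nth[OF p])
  then show ?thesis
  proof (rule total_computable_cong)
    fix xs :: "nat list"
    assume "length xs = n"
    from env_suffix_eq_map[OF p this] show "f (map (\<lambda>g. g xs) ?vars) = f (p xs)"
      by simp
  qed
qed

text \<open>
  The following rules lift the computability of a function on its own arguments to arbitrary
  argument terms, so that each new function needs to be treated only once, on a bare environment.
\<close>

lemma total_computable_compose1:
  assumes "total_computable (Suc 0) (\<lambda>xs. f (hd xs))" "total_computable n a"
  shows "total_computable n (\<lambda>xs. f (a xs))"
  using total_computable_compose[of "[a]" "\<lambda>xs. f (hd xs)" n] assms by simp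

lemma total_computable_compose2:
  assumes "total_computable (Suc (Suc 0)) (\<lambda>xs. f (hd xs) (hd (tl xs)))"
    "total_computable n a" "total_computable n b"
  shows "total_computable n (\<lambda>xs. f (a xs) (b xs))"
  using total_computable_compose[of "[a, b]" "\<lambda>xs. f (hd xs) (hd (tl xs))" n] assms by auto

lemma decidable_compose2:
  assumes "decidable (Suc (Suc 0)) (\<lambda>xs. P (hd xs) (hd (tl xs)))"
    "total_computable n a" "total_computable n b"
  shows "decidable n (\<lambda>xs. P (a xs) (b xs))"
  using total_computable_compose2[of "\<lambda>x y. if P x y then 0 else 1" n a b] assms
  unfolding decidable_def by simp

lemma decidable_compose1:
  assumes "decidable (Suc 0) (\<lambda>xs. P (hd xs))" "total_computable n a"
  shows "decidable n (\<lambda>xs. P (a xs))"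
  using total_computable_compose1[of "\<lambda>x. if P x then 0 else 1" n a] assms
  unfolding decidable_def by simp

lemma decidable_compose3:
  assumes "decidable (Suc (Suc (Suc 0))) (\<lambda>xs. P (hd xs) (hd (tl xs)) (hd (tl (tl xs))))"
    "total_computable n a" "total_computable n b" "total_computable n c"
  shows "decidable n (\<lambda>xs. P (a xs) (b xs) (c xs))"
  using total_computable_compose[of "[a, b, c]"
      "\<lambda>xs. if P (hd xs) (hd (tl xs)) (hd (tl (tl xs))) then 0 else 1" n] assms
  unfolding decidable_def by auto

lemma decidable_compose4:
  assumes "decidable (Suc (Suc (Suc (Suc 0))))
      (\<lambda>xs. P (hd xs) (hd (tl xs)) (hd (tl (tl xs))) (hd (tl (tl (tl xs)))))"
    "total_computable n a" "total_computable n b" "total_computable n c" "total_computable n d"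
  shows "decidable n (\<lambda>xs. P (a xs) (b xs) (c xs) (d xs))"
  using total_computable_compose[of "[a, b, c, d]"
      "\<lambda>xs. if P (hd xs) (hd (tl xs)) (hd (tl (tl xs))) (hd (tl (tl (tl xs)))) then 0 else 1" n] assms
  unfolding decidable_def by auto

lemma total_computable_Suc:
  assumes "total_computable n a"
  shows "total_computable n (\<lambda>xs. Suc (a xs))"
proof (rule total_computable_compose1[OF _ assms])
  show "total_computable (Suc 0) (\<lambda>xs. Suc (hd xs))"
    unfolding total_computable_def
    by (intro exI[of _ Succ]) (auto simp: length_Suc_conv intro: rec_eval.Succ)
qed

lemma total_computable_const: "total_computable n (\<lambda>_. c)"
proof (induction c)
  case 0
  show ?case
    unfolding total_computable_def by (blast intro: rec_eval.Zero)
qed (rule total_computable_Suc)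

text \<open>
  The premise on the step function has the two new variables read off from an environment with two
  more entries; the environment variables must be passed on as projections, as primitive recursion
  keeps its parameters in the argument tuple.
\<close>

lemma total_computable_rec_nat:
  assumes a: "total_computable n a" and b: "total_computable n b"
    and g: "total_computable (Suc (Suc n)) (\<lambda>ys. g (hd ys) (hd (tl ys)) (tl (tl ys)))"
  shows "total_computable n (\<lambda>xs. rec_nat (b xs) (\<lambda>i v. g i v xs) (a xs))"
proof -
  obtain ra where ra: "\<And>xs. length xs = n \<Longrightarrow> rec_eval ra xs (a xs)"
    using a unfolding total_computable_def by blast
  obtain rb where rb: "\<And>xs. length xs = n \<Longrightarrow> rec_eval rb xs (b xs)"
    using b unfolding total_computable_def by blast
  obtain rg where
    rg: "\<And>ys. length ys = Suc (Suc n) \<Longrightarrow> rec_eval rg ys (g (hd ys) (hd (tl ys)) (tl (tl ys)))"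
    using g unfolding total_computable_def by blast
  have rec: "rec_eval (PrimRec rb rg) (k # xs) (rec_nat (b xs) (\<lambda>i v. g i v xs) k)"
    if "length xs = n" for k xs
  proof (induction k)
    case 0
    show ?case using rb[OF that] by (auto intro: rec_eval.PrimRec_0)
  next
    case (Suc k)
    from Suc show ?case
      by (rule rec_eval.PrimRec_Suc) (use rg[of "k # _ # xs"] that in simp)
  qed
  have "rec_eval (Comp (PrimRec rb rg) (ra # map Proj [0..<n])) xs
      (rec_nat (b xs) (\<lambda>i v. g i v xs) (a xs))" if "length xs = n" for xs
  proof (rule rec_eval.Comp[OF _ rec[OF that]])
    show "list_all2 (\<lambda>g. rec_eval g xs) (ra # map Proj [0..<n]) (a xs # xs)"
      using that ra[OF that] by (simp add: list_all2_conv_all_nth rec_eval.Proj All_less_Suc2)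
  qed
  then show ?thesis
    unfolding total_computable_def by blast
qed

lemma rec_eval_Mu_Least:
  assumes r: "\<And>n. rec_eval r (n # xs) (if P n then 0 else 1)" and ex: "\<exists>n. P n"
  shows "rec_eval (Mu r) xs (LEAST n. P n)"
proof (rule rec_eval.Mu)
  show "rec_eval r ((LEAST n. P n) # xs) 0"
    using r[of "LEAST n. P n"] LeastI_ex[OF ex] by simp
  show "\<forall>k<LEAST n. P n. \<exists>y>0. rec_eval r (k # xs) y"
    using r by (metis not_less_Least zero_less_one)
qed

lemma total_computable_Least:
  assumes P: "decidable (Suc n) (\<lambda>ys. P (hd ys) (tl ys))"
    and ex: "\<And>xs. length xs = n \<Longrightarrow> \<exists>i. P i xs"
  shows "total_computable n (\<lambda>xs. LEAST i. P i xs)"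
proof -
  obtain r where "\<And>ys. length ys = Suc n \<Longrightarrow> rec_eval r ys (if P (hd ys) (tl ys) then 0 else 1)"
    using P unfolding decidable_def total_computable_def by blast
  then have r: "rec_eval r (i # xs) (if P i xs then 0 else 1)" if "length xs = n" for i xs
    using that by (metis length_Cons list.sel(1,3))
  show ?thesis
    unfolding total_computable_def using rec_eval_Mu_Least[OF r ex] by blast
qed

lemma total_computable_add:
  assumes a: "total_computable n a" and b: "total_computable n b"
  shows "total_computable n (\<lambda>xs. a xs + b xs)"
proof (rule total_computable_compose2[OF _ a b])
  have "rec_nat y (\<lambda>i v. Suc v) x = x + y" for x y
    by (induction x) auto
  moreover have "total_computable (Suc (Suc 0)) (\<lambda>xs. rec_nat (hd (tl xs)) (\<lambda>i v. Suc v) (hd xs))"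
    by (rule total_computable_rec_nat total_computable_Suc total_computable_hd env_suffix_tl
        env_suffix_self)+
  ultimately show "total_computable (Suc (Suc 0)) (\<lambda>xs. hd xs + hd (tl xs))"
    by simp
qed

lemma total_computable_mult:
  assumes a: "total_computable n a" and b: "total_computable n b"
  shows "total_computable n (\<lambda>xs. a xs * b xs)"
proof (rule total_computable_compose2[OF _ a b])
  have "rec_nat 0 (\<lambda>i v. v + y) x = x * y" for x y :: nat
    by (induction x) auto
  moreover have
    "total_computable (Suc (Suc 0)) (\<lambda>xs. rec_nat 0 (\<lambda>i v. v + hd (tl xs)) (hd xs))"
    by (rule total_computable_rec_nat total_computable_add total_computable_const
        total_computable_hd env_suffix_tl env_suffix_self)+
  ultimately show "total_computable (Suc (Suc 0)) (\<lambda>xs. hd xs * hd (tl xs))"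
    by simp
qed

lemma total_computable_power:
  assumes a: "total_computable n a" and b: "total_computable n b"
  shows "total_computable n (\<lambda>xs. a xs ^ b xs)"
proof (rule total_computable_compose2[OF _ a b])
  have "rec_nat 1 (\<lambda>i v. x * v) y = x ^ y" for x y :: nat
    by (induction y) auto
  moreover have
    "total_computable (Suc (Suc 0)) (\<lambda>xs. rec_nat 1 (\<lambda>i v. hd xs * v) (hd (tl xs)))"
    by (rule total_computable_rec_nat total_computable_mult total_computable_const
        total_computable_hd env_suffix_tl env_suffix_self)+
  ultimately show "total_computable (Suc (Suc 0)) (\<lambda>xs. hd xs ^ hd (tl xs))"
    by simp
qed

lemma total_computable_diff:
  assumes a: "total_computable n a" and b: "total_computable n b"
  shows "total_computable n (\<lambda>xs. a xs - b xs)"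
proof (rule total_computable_compose2[OF _ a b])
  have pred: "rec_nat 0 (\<lambda>i v. i) y = y - 1" for y
    by (cases y) auto
  have "rec_nat x (\<lambda>i v. rec_nat 0 (\<lambda>i v. i) v) y = x - y" for x y :: nat
    by (induction y) (auto simp: pred)
  moreover have "total_computable (Suc (Suc 0))
      (\<lambda>xs. rec_nat (hd xs) (\<lambda>i v. rec_nat 0 (\<lambda>i v. i) v) (hd (tl xs)))"
    by (rule total_computable_rec_nat total_computable_const
        total_computable_hd env_suffix_tl env_suffix_self)+
  ultimately show "total_computable (Suc (Suc 0)) (\<lambda>xs. hd xs - hd (tl xs))"
    by simp
qed

lemma total_computable_if:
  assumes P: "decidable n P" and a: "total_computable n a" and b: "total_computable n b"
  shows "total_computable n (\<lambda>xs. if P xs then a xs else b xs)"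
proof -
  let ?t = "\<lambda>xs. if P xs then 0 else 1 :: nat"
  have "total_computable n (\<lambda>xs. (1 - ?t xs) * a xs + ?t xs * b xs)"
    by (rule total_computable_add total_computable_mult total_computable_diff total_computable_const
        P[unfolded decidable_def] a b)+
  then show ?thesis
    by (rule total_computable_cong) simp
qed

lemma decidable_eq_0:
  assumes "total_computable n a"
  shows "decidable n (\<lambda>xs. a xs = 0)"
proof -
  have "total_computable n (\<lambda>xs. 1 - (1 - a xs))"
    by (rule total_computable_diff total_computable_const assms)+
  then show ?thesis
    unfolding decidable_def by (rule total_computable_cong) simp
qed

lemma decidable_less:
  assumes "total_computable n a" "total_computable n b"
  shows "decidable n (\<lambda>xs. a xs < b xs)"
proof -
  have "decidable n (\<lambda>xs. Suc (a xs) - b xs = 0)"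
    by (rule decidable_eq_0 total_computable_diff total_computable_Suc assms)+
  then show ?thesis
    by (simp add: Suc_le_eq)
qed

lemma decidable_not:
  assumes "decidable n P"
  shows "decidable n (\<lambda>xs. \<not> P xs)"
proof -
  have "total_computable n (\<lambda>xs. if P xs then 1 else 0)"
    by (rule total_computable_if total_computable_const assms)+
  then show ?thesis
    unfolding decidable_def by (rule total_computable_cong) simp
qed

lemma decidable_conj:
  assumes "decidable n P" "decidable n Q"
  shows "decidable n (\<lambda>xs. P xs \<and> Q xs)"
proof -
  have "total_computable n (\<lambda>xs. if P xs then (if Q xs then 0 else 1) else 1)"
    by (rule total_computable_if total_computable_const assms)+
  then show ?thesis
    unfolding decidable_def by (rule total_computable_cong) simp
qed

lemma decidable_disj:
  assumes "decidable n P" "decidable n Q"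
  shows "decidable n (\<lambda>xs. P xs \<or> Q xs)"
  using decidable_not[OF decidable_conj[OF decidable_not[OF assms(1)] decidable_not[OF assms(2)]]]
  by simp

lemma decidable_eq:
  assumes "total_computable n a" "total_computable n b"
  shows "decidable n (\<lambda>xs. a xs = b xs)"
proof -
  have "decidable n (\<lambda>xs. \<not> a xs < b xs \<and> \<not> b xs < a xs)"
    by (rule decidable_conj decidable_not decidable_less assms)+
  then show ?thesis
    by (simp add: not_less eq_iff conj_commute)
qed

text \<open>
  A bounded quantifier counts its counterexamples by primitive recursion.
\<close>

lemma decidable_ball:
  assumes P: "decidable (Suc n) (\<lambda>ys. P (hd ys) (tl ys))" and b: "total_computable n b"
  shows "decidable n (\<lambda>xs. \<forall>i < b xs. P i xs)"
proof -
  let ?failures = "\<lambda>xs. rec_nat 0 (\<lambda>i v. v + (if P i xs then 0 else 1 :: nat))"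
  have iff: "?failures xs k = 0 \<longleftrightarrow> (\<forall>i < k. P i xs)" for xs k
    by (induction k) (auto simp: less_Suc_eq)
  have "total_computable (Suc (Suc n)) (\<lambda>ys. if P (hd ys) (tl (tl ys)) then 0 else 1)"
    by (rule total_computable_bind[of n "\<lambda>i xs. if P i xs then 0 else 1"])
       (rule P[unfolded decidable_def] total_computable_hd env_suffix_tl env_suffix_self)+
  then have "decidable n (\<lambda>xs. ?failures xs (b xs) = 0)"
    by (intro decidable_eq_0 total_computable_rec_nat total_computable_add total_computable_const b)
       (rule total_computable_hd env_suffix_tl env_suffix_self)+
  then show ?thesis
    by (simp only: iff)
qed

lemma decidable_bex:
  assumes "decidable (Suc n) (\<lambda>ys. P (hd ys) (tl ys))" "total_computable n b"
  shows "decidable n (\<lambda>xs. \<exists>i < b xs. P i xs)"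
  using decidable_not[OF decidable_ball[where P = "\<lambda>i xs. \<not> P i xs", OF decidable_not[OF assms(1)] assms(2)]]
  by simp

text \<open>
  These rules follow the syntax of the term. They are used with \<open>rule\<close> and repetition: the length of
  an environment suffix is a schematic variable, which \<open>intro\<close> would refuse to instantiate.
\<close>

lemmas computability_intros =
  total_computable_const total_computable_hd env_suffix_tl env_suffix_self
  total_computable_Suc total_computable_add total_computable_mult total_computable_power
  total_computable_diff total_computable_if
  decidable_less decidable_not decidable_conj decidable_disj decidable_eq
  decidable_ball decidable_bex

section \<open>Lists coded as numbers\<close>

lemma total_computable_prod_encode:
  assumes a: "total_computable n a" and b: "total_computable n b"
  shows "total_computable n (\<lambda>xs. prod_encode (a xs, b xs))"
proof -
  have tri: "rec_nat 0 (\<lambda>i v. v + Suc i) k = triangle k" for k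
    by (induction k) auto
  have "total_computable (Suc 0) (\<lambda>xs. rec_nat 0 (\<lambda>i v. v + Suc i) (hd xs))"
    by (rule total_computable_rec_nat computability_intros)+
  then have "total_computable n (\<lambda>xs. triangle (c xs))" if "total_computable n c" for c
    using that unfolding tri by (rule total_computable_compose1)
  from total_computable_add[OF this[OF total_computable_add[OF a b]] a]
  have "total_computable n (\<lambda>xs. triangle (a xs + b xs) + a xs)" .
  then show ?thesis
    by (simp add: prod_encode_def)
qed

text \<open>
  The projections are found by search, which only needs the pairing function itself.
\<close>

lemma total_computable_fst_decode:
  assumes "total_computable n c"
  shows "total_computable n (\<lambda>xs. fst (prod_decode (c xs)))"
proof (rule total_computable_compose1[OF _ assms])
  have ex: "\<exists>y < Suc z. prod_encode (fst (prod_decode z), y) = z" for z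
    by (metis le_imp_less_Suc le_prod_encode_2 prod.collapse prod_decode_inverse)
  have "(LEAST x. \<exists>y < Suc z. prod_encode (x, y) = z) = fst (prod_decode z)" for z
    by (rule Least_equality) (use ex in auto)
  moreover have
    "total_computable (Suc 0) (\<lambda>xs. LEAST x. \<exists>y < Suc (hd xs). prod_encode (x, y) = hd xs)"
    by (rule total_computable_Least total_computable_prod_encode computability_intros)+
       (use ex in blast)
  ultimately show "total_computable (Suc 0) (\<lambda>xs. fst (prod_decode (hd xs)))"
    by simp
qed

lemma total_computable_snd_decode:
  assumes "total_computable n c"
  shows "total_computable n (\<lambda>xs. snd (prod_decode (c xs)))"
proof (rule total_computable_compose1[OF _ assms])
  have ex: "prod_encode (fst (prod_decode z), snd (prod_decode z)) = z" for z
    by simp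
  have "(LEAST y. prod_encode (fst (prod_decode z), y) = z) = snd (prod_decode z)" for z
    by (rule Least_equality) (simp, metis order_refl prod_encode_inverse snd_conv)
  moreover have
    "total_computable (Suc 0) (\<lambda>xs. LEAST y. prod_encode (fst (prod_decode (hd xs)), y) = hd xs)"
    by (rule total_computable_Least total_computable_prod_encode total_computable_fst_decode
        computability_intros)+ (use ex in blast)
  ultimately show "total_computable (Suc 0) (\<lambda>xs. snd (prod_decode (hd xs)))"
    by simp
qed

definition cons_code :: "nat \<Rightarrow> nat \<Rightarrow> nat" where
  "cons_code x d = Suc (prod_encode (x, d))"

text \<open>
  The code \<open>0\<close> of the empty list is its own tail, because \<open>0 - 1 = 0\<close> codes the pair \<open>(0, 0)\<close>.
\<close>

definition tl_code :: "nat \<Rightarrow> nat" where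
  "tl_code d = snd (prod_decode (d - 1))"

definition drop_code :: "nat \<Rightarrow> nat \<Rightarrow> nat" where
  "drop_code k d = (tl_code ^^ k) d"

definition nth_code :: "nat \<Rightarrow> nat \<Rightarrow> nat" where
  "nth_code d k = fst (prod_decode (drop_code k d - 1))"

definition length_code :: "nat \<Rightarrow> nat" where
  "length_code d = length (list_decode d)"

lemma cons_code: "cons_code x (list_encode l) = list_encode (x # l)"
  by (simp add: cons_code_def)

lemma tl_code: "tl_code (list_encode l) = list_encode (tl l)"
proof (cases l)
  case Nil
  have "prod_encode (0, 0) = 0"
    by (simp add: prod_encode_def)
  then have "prod_decode 0 = (0, 0)"
    by (metis prod_encode_inverse)
  with Nil show ?thesis
    by (simp add: tl_code_def)
qed (simp add: tl_code_def)

lemma drop_code: "drop_code k (list_encode l) = list_encode (drop k l)"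
  by (induction k) (auto simp: drop_code_def tl_code drop_Suc tl_drop)

lemma nth_code: "k < length l \<Longrightarrow> nth_code (list_encode l) k = l ! k"
  by (simp add: nth_code_def drop_code flip: Cons_nth_drop_Suc)

lemma list_encode_eq_0: "list_encode l = 0 \<longleftrightarrow> l = []"
  by (cases l) auto

lemma length_code: "length_code (list_encode l) = length l"
  by (simp add: length_code_def)

lemmas code_simps = cons_code tl_code drop_code nth_code length_code

lemma list_code_cases: obtains l where "d = list_encode l"
  by (metis list_decode_inverse)

lemma length_code_eq_Least: "length_code d = (LEAST k. drop_code k d = 0)"
proof (cases d rule: list_code_cases)
  case (1 l)
  then show ?thesis
    by (auto simp: code_simps list_encode_eq_0 intro!: Least_equality[symmetric])
qed

lemma bex_code_iff: "(\<exists>x \<in> set (list_decode d). P x) \<longleftrightarrow> (\<exists>k < length_code d. P (nth_code d k))"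
proof (cases d rule: list_code_cases)
  case (1 l)
  then show ?thesis
    by (auto simp: length_code nth_code in_set_conv_nth Bex_def cong: conj_cong)
qed

lemma total_computable_cons_code:
  "total_computable n a \<Longrightarrow> total_computable n b \<Longrightarrow> total_computable n (\<lambda>xs. cons_code (a xs) (b xs))"
  unfolding cons_code_def by (rule total_computable_Suc total_computable_prod_encode)+

lemma total_computable_tl_code:
  "total_computable n a \<Longrightarrow> total_computable n (\<lambda>xs. tl_code (a xs))"
  unfolding tl_code_def
  by (rule total_computable_diff total_computable_const total_computable_snd_decode | assumption)+

lemma total_computable_drop_code:
  assumes a: "total_computable n a" and b: "total_computable n b"
  shows "total_computable n (\<lambda>xs. drop_code (a xs) (b xs))"
proof (rule total_computable_compose2[OF _ a b])
  have "rec_nat d (\<lambda>i v. tl_code v) k = drop_code k d" for d k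
    by (induction k) (auto simp: drop_code_def)
  moreover have
    "total_computable (Suc (Suc 0)) (\<lambda>xs. rec_nat (hd (tl xs)) (\<lambda>i v. tl_code v) (hd xs))"
    by (rule total_computable_rec_nat total_computable_tl_code computability_intros)+
  ultimately show "total_computable (Suc (Suc 0)) (\<lambda>xs. drop_code (hd xs) (hd (tl xs)))"
    by simp
qed

lemma total_computable_nth_code:
  "total_computable n a \<Longrightarrow> total_computable n b \<Longrightarrow> total_computable n (\<lambda>xs. nth_code (a xs) (b xs))"
  unfolding nth_code_def
  by (rule total_computable_fst_decode total_computable_diff total_computable_drop_code
      total_computable_const | assumption)+

lemma total_computable_length_code:
  assumes "total_computable n a"
  shows "total_computable n (\<lambda>xs. length_code (a xs))"
proof (rule total_computable_compose1[OF _ assms])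
  have ex: "\<exists>k. drop_code k d = 0" for d
    using drop_code[of "length (list_decode d)" "list_decode d"] by auto
  show "total_computable (Suc 0) (\<lambda>xs. length_code (hd xs))"
    unfolding length_code_eq_Least
    by (rule total_computable_Least total_computable_drop_code computability_intros)+ (rule ex)
qed

text \<open>
  Quantification over the entries of a coded list is bounded quantification over indices.
\<close>

lemma decidable_bex_code:
  assumes P: "decidable (Suc n) (\<lambda>ys. P (hd ys) (tl ys))" and d: "total_computable n d"
  shows "decidable n (\<lambda>xs. \<exists>x \<in> set (list_decode (d xs)). P x xs)"
proof -
  have "total_computable (Suc n)
      (\<lambda>ys. if P (nth_code (d (tl ys)) (hd ys)) (tl ys) then 0 else 1)"
    by (rule total_computable_bind[of n "\<lambda>x xs. if P x xs then 0 else 1"])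
       (rule P[unfolded decidable_def] total_computable_nth_code total_computable_weaken[OF d]
        total_computable_hd env_suffix_tl env_suffix_self)+
  then show ?thesis
    unfolding bex_code_iff decidable_def[of "Suc n", symmetric]
    by (intro decidable_bex total_computable_length_code d)
qed

lemma decidable_mem_code:
  assumes "total_computable n a" "total_computable n d"
  shows "decidable n (\<lambda>xs. a xs \<in> set (list_decode (d xs)))"
proof (rule decidable_compose2[OF _ assms])
  have "decidable (Suc (Suc 0)) (\<lambda>xs. \<exists>x \<in> set (list_decode (hd (tl xs))). x = hd xs)"
    by (rule decidable_bex_code computability_intros)+
  then show "decidable (Suc (Suc 0)) (\<lambda>xs. hd xs \<in> set (list_decode (hd (tl xs))))"
    by simp
qed

lemmas code_intros = computability_intros total_computable_cons_code total_computable_tl_code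
  total_computable_drop_code total_computable_nth_code total_computable_length_code
  decidable_mem_code decidable_bex_code

text \<open>
  Codes of explicit lists are kept folded, so that \<open>code_simps\<close> apply to them.
\<close>

declare list_encode.simps [simp del]

section \<open>Derivations of computations\<close>

text \<open>
  The first entry of a code identifies the program constructor.
\<close>

fun recf_code :: "recf \<Rightarrow> nat" where
  "recf_code Zero = list_encode [0]"
| "recf_code Succ = list_encode [1]"
| "recf_code (Proj i) = list_encode [2, i]"
| "recf_code (Comp f gs) = list_encode (3 # recf_code f # map recf_code gs)"
| "recf_code (PrimRec f g) = list_encode [4, recf_code f, recf_code g]"
| "recf_code (Mu f) = list_encode [5, recf_code f]"

text \<open>
  The number \<open>claim e d y\<close> states that the program with code \<open>e\<close>, run on the argument list with code
  \<open>d\<close>, outputs \<open>y\<close>.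
\<close>

definition claim :: "nat \<Rightarrow> nat \<Rightarrow> nat \<Rightarrow> nat" where
  "claim e d y = cons_code e (cons_code y d)"

text \<open>
  One disjunct for each rule of \<open>rec_eval\<close>, with \<open>S\<close> as the set of claims available as premises.
  Intermediate values, such as the arguments of the outer function of a composition, are recovered
  from a claim \<open>j\<close> in \<open>S\<close>. Thus all quantifiers are bounded, by \<open>S\<close> or by lengths. The equation
  for \<open>j\<close> ensures that \<open>j\<close> really has the form of a claim, rather than being a shorter list whose
  missing entries are read as \<open>0\<close>.
\<close>

definition justified :: "nat set \<Rightarrow> nat \<Rightarrow> nat \<Rightarrow> nat \<Rightarrow> bool" where
  "justified S e d y \<longleftrightarrow>
     nth_code e 0 = 0 \<and> y = 0
   \<or> nth_code e 0 = 1 \<and> length_code d = 1 \<and> y = Suc (nth_code d 0)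
   \<or> nth_code e 0 = 2 \<and> nth_code e 1 < length_code d \<and> y = nth_code d (nth_code e 1)
   \<or> nth_code e 0 = 3 \<and>
       (\<exists>j \<in> S. j = claim (nth_code e 1) (drop_code 2 j) y
          \<and> length_code (drop_code 2 j) = length_code (drop_code 2 e)
          \<and> (\<forall>i < length_code (drop_code 2 e).
                claim (nth_code e (Suc (Suc i))) d (nth_code j (Suc (Suc i))) \<in> S))
   \<or> nth_code e 0 = 4 \<and> 0 < length_code d \<and> nth_code d 0 = 0 \<and> claim (nth_code e 1) (tl_code d) y \<in> S
   \<or> nth_code e 0 = 4 \<and> 0 < length_code d \<and> 0 < nth_code d 0 \<and>
       (\<exists>j \<in> S. j = claim e (cons_code (nth_code d 0 - 1) (tl_code d)) (nth_code j 1)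
          \<and> claim (nth_code e 2) (cons_code (nth_code d 0 - 1) (cons_code (nth_code j 1) (tl_code d))) y \<in> S)
   \<or> nth_code e 0 = 5 \<and> claim (nth_code e 1) (cons_code y d) 0 \<in> S
       \<and> (\<forall>k < y. \<exists>j \<in> S. j = claim (nth_code e 1) (cons_code k d) (nth_code j 1) \<and> 0 < nth_code j 1)"

lemma claim_code: "claim e (list_encode xs) y = list_encode (e # y # xs)"
  by (simp add: claim_def cons_code)

lemma justified_mono: "justified S e d y \<Longrightarrow> S \<subseteq> S' \<Longrightarrow> justified S' e d y"
  unfolding justified_def by (elim disjE) (simp; blast)+

text \<open>
  Soundness of a single step: the constructor of \<open>r\<close> determines which disjunct can hold, and the
  codes of the subprograms are found at fixed positions in the code of \<open>r\<close>.
\<close>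

lemma rec_eval_if_justified:
  assumes S: "\<And>r xs y. claim (recf_code r) (list_encode xs) y \<in> S \<Longrightarrow> rec_eval r xs y"
    and just: "justified S (recf_code r) (list_encode xs) y"
  shows "rec_eval r xs y"
proof (cases r)
  case Zero
  with just show ?thesis
    by (auto simp: justified_def code_simps intro: rec_eval.intros)
next
  case Succ
  with just show ?thesis
    by (auto simp: justified_def code_simps length_Suc_conv intro: rec_eval.intros)
next
  case (Proj i)
  with just show ?thesis
    by (auto simp: justified_def code_simps intro: rec_eval.intros)
next
  case (Comp f gs)
  with just obtain j where j: "j \<in> S" "j = claim (recf_code f) (drop_code 2 j) y"
    "length_code (drop_code 2 j) = length gs"
    "\<And>i. i < length gs \<Longrightarrow> claim (recf_code (gs ! i)) (list_encode xs) (nth_code j (Suc (Suc i))) \<in> S"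
    by (auto simp: justified_def code_simps)
  obtain ys where ys: "drop_code 2 j = list_encode ys"
    by (rule list_code_cases)
  with j(2) have j_eq: "j = list_encode (recf_code f # y # ys)"
    by (simp add: claim_code)
  have len: "length ys = length gs"
    using j(3) ys by (simp add: length_code)
  have "rec_eval f ys y"
    using j(1,2) ys S by simp
  moreover have "list_all2 (\<lambda>g y. rec_eval g xs y) gs ys"
    using j(4) len S by (auto simp: list_all2_conv_all_nth j_eq nth_code)
  ultimately show ?thesis
    unfolding Comp by (blast intro: rec_eval.Comp)
next
  case (PrimRec f g)
  with just have "xs \<noteq> []"
    by (auto simp: justified_def code_simps)
  then obtain n xs' where xs: "xs = n # xs'"
    by (cases xs) auto
  show ?thesis
  proof (cases n)
    case 0
    with just PrimRec xs have "claim (recf_code f) (list_encode xs') y \<in> S"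
      by (auto simp: justified_def code_simps)
    then show ?thesis
      unfolding PrimRec xs 0 by (blast intro: rec_eval.PrimRec_0 S)
  next
    case (Suc k)
    with just PrimRec xs obtain j where
      "j \<in> S" "j = claim (recf_code (PrimRec f g)) (list_encode (k # xs')) (nth_code j (Suc 0))"
      "claim (recf_code g) (list_encode (k # nth_code j (Suc 0) # xs')) y \<in> S"
      by (auto simp: justified_def code_simps)
    then obtain v where
      "claim (recf_code (PrimRec f g)) (list_encode (k # xs')) v \<in> S"
      "claim (recf_code g) (list_encode (k # v # xs')) y \<in> S"
      by metis
    then show ?thesis
      unfolding PrimRec xs Suc by (blast intro: rec_eval.PrimRec_Suc S)
  qed
next
  case (Mu f)
  with just have "claim (recf_code f) (list_encode (y # xs)) 0 \<in> S"
    "\<forall>k < y. \<exists>j \<in> S. j = claim (recf_code f) (list_encode (k # xs)) (nth_code j 1) \<and> 0 < nth_code j 1"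
    by (simp_all add: justified_def code_simps)
  then have "claim (recf_code f) (list_encode (y # xs)) 0 \<in> S"
    "\<forall>k < y. \<exists>v > 0. claim (recf_code f) (list_encode (k # xs)) v \<in> S"
    by metis+
  then show ?thesis
    unfolding Mu by (blast intro: rec_eval.Mu S)
qed

text \<open>
  Lists grow at the front, so every claim has to follow from those behind it.
\<close>

fun derivation :: "nat list \<Rightarrow> bool" where
  "derivation [] \<longleftrightarrow> True"
| "derivation (j # l) \<longleftrightarrow> derivation l \<and> justified (set l) (nth_code j 0) (drop_code 2 j) (nth_code j 1)"

lemma derivation_append: "derivation l \<Longrightarrow> derivation l' \<Longrightarrow> derivation (l @ l')"
  by (induction l) (auto elim: justified_mono)

lemma derivation_sound:
  "derivation l \<Longrightarrow> claim (recf_code r) (list_encode xs) y \<in> set l \<Longrightarrow> rec_eval r xs y"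
proof (induction l arbitrary: r xs y)
  case (Cons j l)
  show ?case
  proof (cases "claim (recf_code r) (list_encode xs) y \<in> set l")
    case False
    with Cons.prems have "justified (set l) (recf_code r) (list_encode xs) y"
      by (auto simp: claim_code code_simps)
    with Cons show ?thesis
      by (auto intro: rec_eval_if_justified)
  qed (use Cons in auto)
qed simp

definition derivable :: "nat \<Rightarrow> bool" where
  "derivable j \<longleftrightarrow> (\<exists>l. derivation l \<and> j \<in> set l)"

text \<open>
  Derivations can be concatenated, hence a rule of \<open>rec_eval\<close> with finitely many premises, even the
  rule for minimization with its premise for every smaller number, needs a single derivation only.
\<close>

lemma derivation_finite_set:
  "finite F \<Longrightarrow> (\<And>j. j \<in> F \<Longrightarrow> derivable j) \<Longrightarrow> \<exists>l. derivation l \<and> F \<subseteq> set l"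
proof (induction F rule: finite_induct)
  case empty
  show ?case by (rule exI[of _ "[]"]) simp
next
  case (insert j F)
  then obtain l l' where "derivation l" "F \<subseteq> set l" "derivation l'" "j \<in> set l'"
    unfolding derivable_def by (metis insertI1 insertI2)
  then show ?case
    by (intro exI[of _ "l @ l'"]) (auto intro: derivation_append)
qed

lemma derivable_if_justified:
  assumes "finite F" "\<And>j. j \<in> F \<Longrightarrow> derivable j" "justified F e d y"
  shows "derivable (claim e d y)"
proof -
  obtain l where l: "derivation l" "F \<subseteq> set l"
    using derivation_finite_set assms(1,2) by blast
  obtain xs where "d = list_encode xs"
    by (rule list_code_cases)
  with l assms(3) have "derivation (claim e d y # l)"
    by (auto simp: claim_code code_simps elim: justified_mono)
  then show ?thesis
    unfolding derivable_def by (meson list.set_intros(1))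
qed

lemma derivation_complete:
  "rec_eval r xs y \<Longrightarrow> derivable (claim (recf_code r) (list_encode xs) y)"
proof (induction r xs y rule: rec_eval.induct)
  case (Zero xs)
  show ?case
    by (rule derivable_if_justified[of "{}"]) (auto simp: justified_def code_simps)
next
  case (Succ x)
  show ?case
    by (rule derivable_if_justified[of "{}"]) (auto simp: justified_def code_simps)
next
  case (Proj i xs)
  then show ?case
    by (intro derivable_if_justified[of "{}"]) (auto simp: justified_def code_simps)
next
  case (Comp xs gs ys f z)
  then have len: "length ys = length gs"
    by (auto dest: list_all2_lengthD)
  let ?F = "insert (claim (recf_code f) (list_encode ys) z)
    ((\<lambda>i. claim (recf_code (gs ! i)) (list_encode xs) (ys ! i)) ` {..<length gs})"
  show ?case
  proof (rule derivable_if_justified[of ?F])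
    show "derivable j" if "j \<in> ?F" for j
      using that Comp.IH by (auto simp: list_all2_conv_all_nth)
    show "justified ?F (recf_code (Comp f gs)) (list_encode xs) z"
      by (auto simp: justified_def code_simps claim_code len)
  qed simp
next
  case (PrimRec_0 f xs y g)
  then show ?case
    by (intro derivable_if_justified[of "{claim (recf_code f) (list_encode xs) y}"])
       (auto simp: justified_def code_simps)
next
  case (PrimRec_Suc f g n xs v y)
  then show ?case
    by (intro derivable_if_justified[of "{claim (recf_code (PrimRec f g)) (list_encode (n # xs)) v,
          claim (recf_code g) (list_encode (n # v # xs)) y}"])
       (auto simp: justified_def code_simps claim_code)
next
  case (Mu f n xs)
  then obtain v where v: "\<And>k. k < n \<Longrightarrow> 0 < v k"
    "\<And>k. k < n \<Longrightarrow> derivable (claim (recf_code f) (list_encode (k # xs)) (v k))"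
    by metis
  let ?F = "insert (claim (recf_code f) (list_encode (n # xs)) 0)
    ((\<lambda>k. claim (recf_code f) (list_encode (k # xs)) (v k)) ` {..<n})"
  show ?case
  proof (rule derivable_if_justified[of ?F])
    show "derivable j" if "j \<in> ?F" for j
      using that Mu.IH v by auto
    show "justified ?F (recf_code (Mu f)) (list_encode xs) n"
      using v(1) by (auto simp: justified_def code_simps claim_code)
  qed simp
qed

lemma rec_eval_iff_derivable:
  "rec_eval r xs y \<longleftrightarrow> derivable (claim (recf_code r) (list_encode xs) y)"
  using derivation_complete derivation_sound unfolding derivable_def by blast

lemma total_computable_claim:
  "total_computable n a \<Longrightarrow> total_computable n b \<Longrightarrow> total_computable n c \<Longrightarrow>
    total_computable n (\<lambda>xs. claim (a xs) (b xs) (c xs))"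
  unfolding claim_def by (intro total_computable_cons_code)

lemma decidable_justified:
  assumes "total_computable n s" "total_computable n e" "total_computable n d" "total_computable n y"
  shows "decidable n (\<lambda>xs. justified (set (list_decode (s xs))) (e xs) (d xs) (y xs))"
proof (rule decidable_compose4[OF _ assms])
  show "decidable (Suc (Suc (Suc (Suc 0))))
     (\<lambda>xs. justified (set (list_decode (hd xs))) (hd (tl xs)) (hd (tl (tl xs))) (hd (tl (tl (tl xs)))))"
    unfolding justified_def by (rule total_computable_claim code_intros)+
qed

lemma derivation_iff_nth:
  "derivation l \<longleftrightarrow>
    (\<forall>i < length l. justified (set (drop (Suc i) l)) (nth_code (l ! i) 0) (drop_code 2 (l ! i)) (nth_code (l ! i) 1))"
  by (induction l) (auto simp: All_less_Suc2)

lemma decidable_derivation: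
  assumes "total_computable n d"
  shows "decidable n (\<lambda>xs. derivation (list_decode (d xs)))"
proof (rule decidable_compose1[OF _ assms])
  have "derivation (list_decode d) \<longleftrightarrow> (\<forall>i < length_code d.
      justified (set (list_decode (drop_code (Suc i) d))) (nth_code (nth_code d i) 0)
        (drop_code 2 (nth_code d i)) (nth_code (nth_code d i) 1))" for d
    by (cases d rule: list_code_cases) (simp add: derivation_iff_nth code_simps)
  moreover have "decidable (Suc 0) (\<lambda>xs. \<forall>i < length_code (hd xs).
      justified (set (list_decode (drop_code (Suc i) (hd xs)))) (nth_code (nth_code (hd xs) i) 0)
        (drop_code 2 (nth_code (hd xs) i)) (nth_code (nth_code (hd xs) i) 1))"
    by (rule decidable_justified code_intros)+
  ultimately show "decidable (Suc 0) (\<lambda>xs. derivation (list_decode (hd xs)))"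
    by simp
qed

text \<open>
  A stage bounds the code of the derivation. This makes the relation decidable and monotone in the
  stage, and in the limit it exhausts the true claims about unary computations.
\<close>

definition verified :: "nat \<Rightarrow> nat \<Rightarrow> nat \<Rightarrow> nat \<Rightarrow> bool" where
  "verified s e x y \<longleftrightarrow> (\<exists>d < s. derivation (list_decode d)
     \<and> claim e (cons_code x 0) y \<in> set (list_decode d))"

lemma verified_mono: "verified s e x y \<Longrightarrow> s \<le> s' \<Longrightarrow> verified s' e x y"
  unfolding verified_def by (meson order_less_le_trans)

lemma rec_eval_iff_verified: "rec_eval r [x] y \<longleftrightarrow> (\<exists>s. verified s (recf_code r) x y)"
proof -
  have "cons_code x 0 = list_encode [x]"
    using cons_code[of x "[]"] by (simp add: list_encode.simps)
  then have "(\<exists>s. verified s (recf_code r) x y) \<longleftrightarrow>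
      (\<exists>d. derivation (list_decode d) \<and> claim (recf_code r) (list_encode [x]) y \<in> set (list_decode d))"
    unfolding verified_def by auto
  also have "\<dots> \<longleftrightarrow> derivable (claim (recf_code r) (list_encode [x]) y)"
    unfolding derivable_def by (metis list_encode_inverse)
  finally show ?thesis
    by (simp add: rec_eval_iff_derivable)
qed

lemma decidable_verified:
  assumes "total_computable n s" "total_computable n e" "total_computable n x" "total_computable n y"
  shows "decidable n (\<lambda>xs. verified (s xs) (e xs) (x xs) (y xs))"
proof (rule decidable_compose4[OF _ assms])
  show "decidable (Suc (Suc (Suc (Suc 0))))
     (\<lambda>xs. verified (hd xs) (hd (tl xs)) (hd (tl (tl xs))) (hd (tl (tl (tl xs)))))"
    unfolding verified_def by (rule decidable_derivation total_computable_claim code_intros)+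
qed

section \<open>Partial computable functions from decidable relations\<close>

lemma partial_computable_if_total:
  assumes "\<And>x. rec_eval r [x] (f x)"
  shows "partial_computable (\<lambda>x. Some (f x))"
  unfolding partial_computable_def using assms rec_eval_deterministic by (metis option.inject)

lemma partial_computable_semidecision:
  assumes "decidable (Suc (Suc 0)) (\<lambda>xs. R (hd xs) (hd (tl xs)))"
  shows "partial_computable (\<lambda>x. if \<exists>s. R s x then Some c else None)"
proof -
  obtain r where "\<And>xs. length xs = Suc (Suc 0) \<Longrightarrow> rec_eval r xs (if R (hd xs) (hd (tl xs)) then 0 else 1)"
    using assms unfolding decidable_def total_computable_def by blast
  then have r: "rec_eval r [s, x] (if R s x then 0 else 1)" for s x
    by (metis length_Cons list.sel(1,3) list.size(3))
  obtain rc where rc: "\<And>n. rec_eval rc [n] c"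
    using total_computable_const[of "Suc 0" c] unfolding total_computable_def
    by (metis length_Cons list.size(3))
  have "rec_eval (Comp rc [Mu r]) [x] y \<longleftrightarrow> (\<exists>s. R s x) \<and> y = c" for x y
  proof
    assume "rec_eval (Comp rc [Mu r]) [x] y"
    then obtain s where s: "rec_eval (Mu r) [x] s" "rec_eval rc [s] y"
      by cases (auto simp: list_all2_Cons1)
    from s(1) have "rec_eval r [s, x] 0"
      by cases simp
    with r[of s x] have "R s x"
      by (metis rec_eval_deterministic zero_neq_one)
    with s(2) rc show "(\<exists>s. R s x) \<and> y = c"
      using rec_eval_deterministic by blast
  next
    assume "(\<exists>s. R s x) \<and> y = c"
    then show "rec_eval (Comp rc [Mu r]) [x] y"
      using rec_eval_Mu_Least[of r "[x]" "\<lambda>s. R s x"] r rc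
      by (intro rec_eval.Comp[of "[x]" _ "[LEAST s. R s x]"]) auto
  qed
  then show ?thesis
    unfolding partial_computable_def by (intro exI[of _ "Comp rc [Mu r]"]) auto
qed

text \<open>
  The decided domain controls a primitive recursion of length \<open>0\<close> or \<open>1\<close>. Recursion of length \<open>0\<close>
  never evaluates the step function, so \<open>\<phi>\<close> is only run where it is defined.
\<close>

lemma partial_computable_fill_0:
  assumes "partial_computable \<phi>" "computable_set (dom \<phi>)"
  shows "partial_computable (\<lambda>x. Some (case \<phi> x of None \<Rightarrow> 0 | Some y \<Rightarrow> y))"
proof -
  obtain r where r: "\<And>x y. \<phi> x = Some y \<longleftrightarrow> rec_eval r [x] y"
    using assms(1) unfolding partial_computable_def by blast
  obtain d where d: "\<And>x. rec_eval d [x] (indicator (dom \<phi>) x)"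
    using assms(2) unfolding computable_set_def partial_computable_def by blast
  let ?branch = "PrimRec Zero (Comp r [Proj 2])"
  have branch: "rec_eval ?branch [indicator (dom \<phi>) x, x] (case \<phi> x of None \<Rightarrow> 0 | Some y \<Rightarrow> y)" for x
  proof (cases "\<phi> x")
    case None
    then have "indicator (dom \<phi>) x = (0 :: nat)"
      by (simp add: indicator_def domIff)
    then show ?thesis
      using None by (auto intro: rec_eval.intros)
  next
    case (Some y)
    then have ind: "indicator (dom \<phi>) x = Suc 0"
      by (simp add: indicator_def domIff)
    have "rec_eval (Proj 2) [0, 0, x] x"
      using rec_eval.Proj[of 2 "[0, 0, x]"] by simp
    then have "rec_eval (Comp r [Proj 2]) [0, 0, x] y"
      using Some r by (intro rec_eval.Comp[of _ _ "[x]"]) auto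
    then have "rec_eval ?branch [Suc 0, x] y"
      by (rule rec_eval.PrimRec_Suc[rotated]) (intro rec_eval.intros)
    then show ?thesis
      by (simp add: ind Some)
  qed
  have "rec_eval (Comp ?branch [d, Proj 0]) [x] (case \<phi> x of None \<Rightarrow> 0 | Some y \<Rightarrow> y)" for x
    using rec_eval.Proj[of 0 "[x]"] d
    by (intro rec_eval.Comp[OF _ branch]) auto
  then show ?thesis
    by (rule partial_computable_if_total)
qed

section \<open>Density one\<close>

text \<open>
  Missing elements are easier to estimate than present ones, since unions of exceptional sets simply
  add up.
\<close>

lemma has_density_1_iff:
  "has_density S 1 \<longleftrightarrow> (\<lambda>n. real (card ({0..n} - S)) / real (n + 1)) \<longlonglongrightarrow> 0"
proof -
  have "real (card (S \<inter> {0..n})) / real (n + 1) = 1 - real (card ({0..n} - S)) / real (n + 1)" for n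
  proof -
    have "card (S \<inter> {0..n}) + card ({0..n} - S) = card ({0..n})"
      by (metis Int_commute card_Int_Diff finite_atLeastAtMost)
    then have "real (card (S \<inter> {0..n})) = real (n + 1) - real (card ({0..n} - S))"
      by simp
    then show ?thesis
      by (simp add: diff_divide_distrib)
  qed
  moreover have "(\<lambda>n. 1 - f n) \<longlonglongrightarrow> 1 \<longleftrightarrow> f \<longlonglongrightarrow> 0" for f :: "nat \<Rightarrow> real"
    using tendsto_diff[of "\<lambda>_. 1" 1 sequentially f 0] tendsto_diff[of "\<lambda>_. 1" 1 sequentially "\<lambda>n. 1 - f n" 1]
    by auto
  ultimately show ?thesis
    unfolding has_density_def by simp
qed

lemma has_density_1_Int:
  assumes "has_density S 1" "has_density T 1"
  shows "has_density (S \<inter> T) 1"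
proof -
  let ?miss = "\<lambda>S n. real (card ({0..n} - S)) / real (n + 1)"
  have bound: "?miss (S \<inter> T) n \<le> ?miss S n + ?miss T n" for n
  proof -
    have "card ({0..n} - S \<inter> T) \<le> card ({0..n} - S) + card ({0..n} - T)"
      by (simp add: Diff_Int card_Un_le)
    then show ?thesis
      by (simp add: divide_right_mono flip: add_divide_distrib of_nat_add)
  qed
  have "(\<lambda>n. ?miss S n + ?miss T n) \<longlonglongrightarrow> 0"
    using assms tendsto_add[of "?miss S" 0 sequentially "?miss T" 0] by (simp add: has_density_1_iff)
  then show ?thesis
    unfolding has_density_1_iff
    by (rule tendsto_sandwich[OF _ _ tendsto_const, rotated 2]) (use bound in auto)
qed

lemma card_multiples_le: "card {x \<in> {0..n}. k dvd x} \<le> Suc (n div k)" if "0 < k" for k n :: nat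
proof -
  have "{x \<in> {0..n}. k dvd x} \<subseteq> (\<lambda>i. k * i) ` {0..n div k}"
    using that by (auto simp: dvd_def less_eq_div_iff_mult_less_eq mult.commute intro!: imageI)
  from surj_card_le[OF _ this] show ?thesis
    by simp
qed

text \<open>
  Apart from finitely many exceptions the complement consists of multiples of \<open>2 ^ k\<close>, hence its upper
  density is at most \<open>2 ^ -k\<close>, for every \<open>k\<close>.
\<close>

lemma has_density_1_if_finite_mod_powers:
  assumes "\<And>k. finite {x. x \<notin> S \<and> \<not> 2 ^ k dvd x}"
  shows "has_density S 1"
  unfolding has_density_1_iff
proof (rule LIMSEQ_I)
  fix r :: real
  assume "0 < r"
  then obtain k where k: "(1 / 2) ^ k < r / 2"
    using real_arch_pow_inv[of "r / 2" "1 / 2"] by auto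
  let ?F = "{x. x \<notin> S \<and> \<not> 2 ^ k dvd x}"
  obtain N where N: "real (card ?F + 1) / (r / 2) < real N"
    using reals_Archimedean2 by blast
  have "norm (real (card ({0..n} - S)) / real (n + 1) - 0) < r" if "N \<le> n" for n
  proof -
    have "card ({0..n} - S) \<le> card (?F \<union> {x \<in> {0..n}. 2 ^ k dvd x})"
      using assms[of k] by (intro card_mono) auto
    also have "\<dots> \<le> card ?F + card {x \<in> {0..n}. 2 ^ k dvd x}"
      by (rule card_Un_le)
    also have "\<dots> \<le> card ?F + Suc (n div 2 ^ k)"
      using card_multiples_le[of "2 ^ k" n] by simp
    finally have "real (card ({0..n} - S)) \<le> real (card ?F + 1) + real (n div 2 ^ k)"
      by linarith
    moreover have "real (n div 2 ^ k) \<le> real n * (r / 2)"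
    proof -
      have "real (n div 2 ^ k) \<le> real n * (1 / 2) ^ k"
        using of_nat_div_le_of_nat[of n "2 ^ k", where 'a = real] by (simp add: power_one_over)
      also have "\<dots> \<le> real n * (r / 2)"
        using k by (intro mult_left_mono) auto
      finally show ?thesis .
    qed
    moreover have "real (card ?F + 1) < real n * (r / 2)"
    proof -
      have "real (card ?F + 1) < real N * (r / 2)"
        using N \<open>0 < r\<close> by (simp only: pos_divide_less_eq half_gt_zero)
      also have "\<dots> \<le> real n * (r / 2)"
        using that \<open>0 < r\<close> by (intro mult_right_mono) auto
      finally show ?thesis .
    qed
    ultimately have "real (card ({0..n} - S)) < r * real n"
      by (simp add: mult.commute)
    also have "\<dots> \<le> r * real (n + 1)"
      using \<open>0 < r\<close> by simp
    finally show ?thesis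
      by (simp add: pos_divide_less_eq)
  qed
  then show "\<exists>N. \<forall>n \<ge> N. norm (real (card ({0..n} - S)) / real (n + 1) - 0) < r"
    by blast
qed

text \<open>
  Numbers in \<open>{2 ^ m..<2 ^ Suc m}\<close> with exactly \<open>e\<close> factors \<open>2\<close>, where the bound on \<open>q\<close>
  lets membership be decided by a bounded quantifier.
\<close>

definition block :: "nat \<Rightarrow> nat \<Rightarrow> nat set" where
  "block e m = {x. 2 ^ m \<le> x \<and> x < 2 ^ Suc m \<and> (\<exists>q < x. x = 2 ^ e * (2 * q + 1))}"

lemma less_power_times_odd: "q < 2 ^ e * (2 * q + 1)" for q e :: nat
  using mult_le_mono1[of 1 "2 ^ e" "2 * q + 1"] by simp

lemma block_exists:
  assumes "0 < x"
  obtains e m where "x \<in> block e m"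
proof -
  obtain m where m: "2 ^ m \<le> x" "x < 2 ^ Suc m"
    using ex_power_ivl1[of 2 x] assms by auto
  have "\<exists>e q. x = 2 ^ e * (2 * q + 1)"
    using assms
  proof (induction x rule: less_induct)
    case (less x)
    show ?case
    proof (cases "even x")
      case True
      then obtain y where y: "x = 2 * y"
        by blast
      with less obtain e q where "y = 2 ^ e * (2 * q + 1)"
        by (metis mult_2 nat_0_less_mult_iff less_add_same_cancel1)
      with y have "x = 2 ^ Suc e * (2 * q + 1)"
        by simp
      then show ?thesis
        by blast
    next
      case False
      then obtain q where "x = 2 ^ 0 * (2 * q + 1)"
        by (auto elim: oddE)
      then show ?thesis
        by blast
    qed
  qed
  then obtain e q where x: "x = 2 ^ e * (2 * q + 1)"
    by blast
  then have "q < x"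
    using less_power_times_odd by simp
  with m x show ?thesis
    by (intro that[of e m]) (auto simp: block_def)
qed

lemma block_unique:
  assumes "x \<in> block e m" "x \<in> block e' m'"
  shows "e = e'" "m = m'"
proof -
  have "\<not> m < m'" if "x \<in> block e m" "x \<in> block e' m'" for e m e' m'
  proof
    assume "m < m'"
    then have "(2 :: nat) ^ Suc m \<le> 2 ^ m'"
      by (intro power_increasing) auto
    with that show False
      by (auto simp: block_def)
  qed
  with assms show "m = m'"
    by (meson linorder_neqE_nat)
  have "\<not> e < e'" if x: "x \<in> block e m" "x \<in> block e' m'" for e m e' m'
  proof
    assume "e < e'"
    then have "(2 :: nat) ^ Suc e dvd 2 ^ e'"
      by (intro le_imp_power_dvd) auto
    moreover have "2 ^ e' dvd x"
      using that(2) by (auto simp: block_def)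
    ultimately have "2 ^ e * 2 dvd x"
      by (metis dvd_trans mult.commute power_Suc)
    moreover obtain q where "x = 2 ^ e * (2 * q + 1)"
      using x(1) unfolding block_def by blast
    ultimately have "2 dvd 2 * q + 1"
      by (metis dvd_times_left_cancel_iff power_not_zero zero_neq_numeral)
    then show False
      by simp
  qed
  with assms show "e = e'"
    by (meson linorder_neqE_nat)
qed

text \<open>
  The elements are \<open>2 ^ e * (2 * q + 1)\<close> for \<open>2 ^ i \<le> q < 2 ^ Suc i\<close>.
\<close>

lemma card_block_ge: "2 ^ i \<le> card (block e (Suc (e + i)))"
proof -
  have "(\<lambda>q. 2 ^ e * (2 * q + 1)) ` {2 ^ i..<2 ^ Suc i} \<subseteq> block e (Suc (e + i))"
  proof safe
    fix q :: nat
    assume q: "q \<in> {2 ^ i..<2 ^ Suc i}"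
    have "(2 :: nat) ^ e * (2 * 2 ^ i) \<le> 2 ^ e * (2 * q + 1)" "2 ^ e * (2 * q + 1) < 2 ^ e * (2 * 2 ^ Suc i)"
      using q by (intro mult_le_mono2 mult_less_mono2; simp)+
    then show "2 ^ e * (2 * q + 1) \<in> block e (Suc (e + i))"
      unfolding block_def mem_Collect_eq using less_power_times_odd[of q e]
      by (intro conjI exI[of _ q]) (simp_all add: power_add mult.left_commute)
  qed
  moreover have "inj_on (\<lambda>q. 2 ^ e * (2 * q + 1) :: nat) {2 ^ i..<2 ^ Suc i}"
    by (auto simp: inj_on_def)
  moreover have "finite (block e (Suc (e + i)))"
    by (rule finite_subset[of _ "{..<2 ^ Suc (Suc (e + i))}"]) (auto simp: block_def)
  ultimately have "card {2 ^ i..<2 ^ Suc i :: nat} \<le> card (block e (Suc (e + i)))"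
    by (metis card_image card_mono)
  then show ?thesis
    by simp
qed

text \<open>
  Just below \<open>2 ^ Suc m\<close>, missing the block leaves a proportion of at least \<open>2 ^ i / 2 ^ Suc m\<close> missing,
  where \<open>m = Suc (e + i)\<close>, and this is \<open>2 ^ -(e + 2)\<close> independently of \<open>m\<close>.
\<close>

lemma not_has_density_1_if_misses_blocks:
  assumes "\<And>k. \<exists>m \<ge> k. block e m \<inter> S = {}"
  shows "\<not> has_density S 1"
proof
  assume "has_density S 1"
  then have "\<forall>\<^sub>F n in sequentially. real (card ({0..n} - S)) / real (n + 1) < 1 / 2 ^ (e + 2)"
    unfolding has_density_1_iff by (rule order_tendstoD(2)) simp
  then obtain N where N: "\<And>n. N \<le> n \<Longrightarrow> real (card ({0..n} - S)) / real (n + 1) < 1 / 2 ^ (e + 2)"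
    unfolding eventually_sequentially by blast
  obtain m where m: "Suc (e + N) \<le> m" "block e m \<inter> S = {}"
    using assms by blast
  define i where "i = m - Suc e"
  have i: "m = Suc (e + i)" "N \<le> i"
    using m(1) unfolding i_def by auto
  let ?n = "2 ^ Suc m - 1 :: nat"
  have "block e m \<subseteq> {0..?n} - S"
    using m(2) by (auto simp: block_def)
  then have "2 ^ i \<le> card ({0..?n} - S)"
    using card_block_ge[of i e] i(1) by (meson card_mono finite_Diff finite_atLeastAtMost order_trans)
  then have "2 ^ i \<le> real (card ({0..?n} - S))"
    by (metis of_nat_le_iff of_nat_numeral of_nat_power)
  moreover have "real (?n + 1) = 2 ^ (e + 2) * 2 ^ i"
    using i(1) by (simp add: of_nat_diff power_add)
  ultimately have "1 / 2 ^ (e + 2) \<le> real (card ({0..?n} - S)) / real (?n + 1)"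
    by (simp add: field_simps)
  moreover have "N \<le> ?n"
    using i less_exp[of "Suc m"] by linarith
  ultimately show False
    using N[of ?n] by linarith
qed

section \<open>Withholding blocks\<close>

definition cleared :: "nat \<Rightarrow> nat \<Rightarrow> nat \<Rightarrow> bool" where
  "cleared s e m \<longleftrightarrow> (\<forall>x < 2 ^ Suc m. x \<in> block e m \<longrightarrow> verified s e x 0)"

text \<open>
  The index of the block that is withheld for program \<open>e\<close> at stage \<open>s\<close>. After clearing a block, the
  index jumps to the current stage number: every block with a smaller index is thereby released, so no
  block is withheld a second time.
\<close>

fun withheld :: "nat \<Rightarrow> nat \<Rightarrow> nat" where
  "withheld 0 e = 0"
| "withheld (Suc s) e = (if cleared s e (withheld s e) then Suc s else withheld s e)"

text \<open>
  A block is first considered at the stage equal to its index. Being different from the withheld block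
  at one such stage means that it is not withheld at any later stage either, so a single existential
  quantifier suffices and the set is computably enumerable.
\<close>

definition released :: "nat set" where
  "released = {x. \<exists>s e m. x \<in> block e m \<and> m \<le> s \<and> withheld s e \<noteq> m}"

text \<open>
  The index of a withheld block is the stage at which it began to be withheld, and it has been
  withheld at all stages since.
\<close>

lemma withheld_stable: "withheld s e \<le> t \<Longrightarrow> t \<le> s \<Longrightarrow> withheld t e = withheld s e"
  by (induction s) (auto simp: le_Suc_eq split: if_splits)

lemma decidable_block:
  assumes "total_computable n e" "total_computable n m" "total_computable n x"
  shows "decidable n (\<lambda>xs. x xs \<in> block (e xs) (m xs))"
proof (rule decidable_compose3[OF _ assms])
  have "decidable (Suc (Suc (Suc 0))) (\<lambda>xs. \<not> hd (tl (tl xs)) < 2 ^ hd (tl xs) \<and>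
      hd (tl (tl xs)) < 2 ^ Suc (hd (tl xs)) \<and>
      (\<exists>q < hd (tl (tl xs)). hd (tl (tl xs)) = 2 ^ hd xs * (2 * q + 1)))"
    by (rule computability_intros)+
  then show "decidable (Suc (Suc (Suc 0))) (\<lambda>xs. hd (tl (tl xs)) \<in> block (hd xs) (hd (tl xs)))"
    by (simp add: block_def not_less)
qed

lemma decidable_cleared:
  assumes "total_computable n s" "total_computable n e" "total_computable n m"
  shows "decidable n (\<lambda>xs. cleared (s xs) (e xs) (m xs))"
proof (rule decidable_compose3[OF _ assms])
  have "decidable (Suc (Suc (Suc 0))) (\<lambda>xs. \<forall>x < 2 ^ Suc (hd (tl (tl xs))).
      \<not> x \<in> block (hd (tl xs)) (hd (tl (tl xs))) \<or> verified (hd xs) (hd (tl xs)) x 0)"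
    by (rule decidable_block decidable_verified computability_intros)+
  then show "decidable (Suc (Suc (Suc 0))) (\<lambda>xs. cleared (hd xs) (hd (tl xs)) (hd (tl (tl xs))))"
    unfolding cleared_def imp_conv_disj .
qed

lemma total_computable_withheld:
  assumes "total_computable n s" "total_computable n e"
  shows "total_computable n (\<lambda>xs. withheld (s xs) (e xs))"
proof (rule total_computable_compose2[OF _ assms])
  have "rec_nat 0 (\<lambda>i v. if cleared i e v then Suc i else v) s = withheld s e" for s e
    by (induction s) auto
  moreover have "total_computable (Suc (Suc 0))
      (\<lambda>xs. rec_nat 0 (\<lambda>i v. if cleared i (hd (tl xs)) v then Suc i else v) (hd xs))"
    by (rule total_computable_rec_nat decidable_cleared computability_intros)+
  ultimately show "total_computable (Suc (Suc 0)) (\<lambda>xs. withheld (hd xs) (hd (tl xs)))"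
    by simp
qed

lemma block_bounds: "x \<in> block e m \<Longrightarrow> e < x \<and> m < x"
proof -
  assume "x \<in> block e m"
  then have "2 ^ m \<le> x" "2 ^ e \<le> x"
    by (auto simp: block_def)
  then show ?thesis
    using less_exp[of m] less_exp[of e] by linarith
qed

lemma generic_algorithm_released:
  assumes "has_density released 1"
  shows "generic_algorithm released (\<lambda>x. if x \<in> released then Some 1 else None)"
proof -
  let ?R = "\<lambda>s x. \<exists>e < x. \<exists>m < x. x \<in> block e m \<and> \<not> s < m \<and> withheld s e \<noteq> m"
  have "x \<in> released \<longleftrightarrow> (\<exists>s. ?R s x)" for x
    unfolding released_def mem_Collect_eq not_less using block_bounds by blast
  moreover have "decidable (Suc (Suc 0)) (\<lambda>xs. ?R (hd xs) (hd (tl xs)))"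
    by (rule decidable_block total_computable_withheld computability_intros)+
  ultimately have "partial_computable (\<lambda>x. if x \<in> released then Some 1 else None)"
    using partial_computable_semidecision[of ?R 1] by simp
  moreover have "dom (\<lambda>x. if x \<in> released then Some 1 else None) = released"
    by (auto simp: dom_def)
  ultimately show ?thesis
    using assms unfolding generic_algorithm_def generic_description_def
    by (auto simp: ran_def split: if_splits)
qed

text \<open>
  For each \<open>e\<close> at most one index is withheld at all late stages, so \<open>e < k\<close> contribute finitely many
  missing numbers, and all other missing positive numbers are multiples of \<open>2 ^ k\<close>.
\<close>

lemma has_density_released: "has_density released 1"
proof (rule has_density_1_if_finite_mod_powers)
  fix k
  have "\<exists>M. \<forall>m. (\<forall>s \<ge> m. withheld s e = m) \<longrightarrow> m = M" for e
    by (metis nle_le)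
  then obtain M where M: "\<And>e m. (\<forall>s \<ge> m. withheld s e = m) \<Longrightarrow> m = M e"
    by metis
  have "{x. x \<notin> released \<and> \<not> 2 ^ k dvd x} \<subseteq> (\<Union>e < k. {..<2 ^ Suc (M e)})"
  proof safe
    fix x :: nat
    assume x: "x \<notin> released" "\<not> 2 ^ k dvd x"
    then have "0 < x"
      by (intro Nat.gr0I) auto
    then obtain e m where em: "x \<in> block e m"
      by (rule block_exists)
    then have "2 ^ e dvd x"
      by (auto simp: block_def)
    with x(2) have "e < k"
      by (meson dvd_trans le_imp_power_dvd not_less)
    moreover have "m = M e"
      using x(1) em by (intro M) (auto simp: released_def)
    ultimately show "x \<in> (\<Union>e < k. {..<2 ^ Suc (M e)})"
      using em by (auto simp: block_def)
  qed
  then show "finite {x. x \<notin> released \<and> \<not> 2 ^ k dvd x}"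
    by (rule finite_subset) auto
qed

text \<open>
  The diagonal argument. A block withheld forever contains no element of \<open>C\<close>, so all its elements are
  eventually verified to have output \<open>0\<close> and it is cleared. Hence blocks are cleared infinitely often,
  and every cleared block is disjoint from \<open>C\<close>.
\<close>

lemma released_no_computable_dense_subset:
  assumes "computable_set C" "C \<subseteq> released"
  shows "\<not> has_density C 1"
proof -
  obtain r where r: "\<And>x y. indicator C x = y \<longleftrightarrow> rec_eval r [x] y"
    using assms(1) unfolding computable_set_def partial_computable_def by auto
  define e where "e = recf_code r"
  have verified: "x \<notin> C \<longleftrightarrow> (\<exists>s. verified s e x 0)" for x
    using r[of x 0] unfolding e_def rec_eval_iff_verified by (simp add: indicator_def)
  have cleared_again: "\<exists>s \<ge> k. cleared s e (withheld s e)" for k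
  proof (rule ccontr)
    assume "\<not> ?thesis"
    then have not_cleared: "\<And>s. k \<le> s \<Longrightarrow> \<not> cleared s e (withheld s e)"
      by blast
    define m where "m = withheld k e"
    have stuck: "withheld s e = m" if "m \<le> s" for s
    proof (cases "s \<le> k")
      case True
      then show ?thesis using that withheld_stable unfolding m_def by blast
    next
      case False
      then have "k \<le> s" by simp
      then show ?thesis
      proof (induction s rule: dec_induct)
        case (step s)
        with not_cleared[of s] show ?case
          by simp
      qed (simp add: m_def)
    qed
    have "x \<notin> released" if "x \<in> block e m" for x
      using that stuck block_unique unfolding released_def by blast
    then have "\<exists>s. verified s e x 0" if "x \<in> block e m" for x
      using that assms(2) verified by blast
    then obtain s where s: "\<And>x. x \<in> block e m \<Longrightarrow> verified (s x) e x 0"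
      by metis
    \<comment> \<open>a stage beyond \<open>k\<close> and \<open>m\<close> by which all elements of the block have been verified\<close>
    define t where "t = Max (insert (max k m) (s ` {..<2 ^ Suc m}))"
    have "cleared t e m"
      unfolding cleared_def
    proof (intro allI impI)
      fix x
      assume "x < 2 ^ Suc m" "x \<in> block e m"
      then have "s x \<le> t"
        unfolding t_def by (intro Max_ge) auto
      with s[OF \<open>x \<in> block e m\<close>] show "verified t e x 0"
        by (rule verified_mono)
    qed
    moreover have "max k m \<le> t"
      unfolding t_def by (intro Max_ge) auto
    ultimately show False
      using not_cleared stuck by auto
  qed
  show ?thesis
  proof (rule not_has_density_1_if_misses_blocks)
    fix k
    obtain s where s: "k \<le> s" "cleared s e (withheld s e)"
      using cleared_again by blast
    \<comment> \<open>clearing at stage \<open>s\<close> moves the index beyond \<open>s\<close>, so the block cleared next has a large index\<close>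
    obtain t where t: "Suc s \<le> t" "cleared t e (withheld t e)"
      using cleared_again by blast
    have "withheld s' e \<ge> Suc s" if "Suc s \<le> s'" for s'
      using that by (induction s' rule: dec_induct) (auto simp: s(2))
    then have "k \<le> withheld t e"
      using s(1) t(1) by (meson Suc_leD order_trans)
    moreover have "block e (withheld t e) \<inter> C = {}"
      using t(2) verified unfolding cleared_def by (force simp: block_def)
    ultimately show "\<exists>m \<ge> k. block e m \<inter> C = {}"
      by blast
  qed
qed

theorem corollary2p24:
  "\<exists>A :: nat set. generically_computable A \<and> has_density A 1 \<and>
     (\<forall>\<Phi>. generic_algorithm A \<Phi> \<longrightarrow> \<not> computable_set (dom \<Phi>))"
proof (intro exI conjI allI impI)
  show "generically_computable released"
    unfolding generically_computable_def
    using generic_algorithm_released[OF has_density_released] by blast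
  show "has_density released 1"
    by (rule has_density_released)
  fix \<Phi>
  assume "generic_algorithm released \<Phi>"
  then have \<Phi>: "partial_computable \<Phi>" "ran \<Phi> \<subseteq> {0, 1}" "has_density (dom \<Phi>) 1"
    "\<And>x. x \<in> dom \<Phi> \<Longrightarrow> \<Phi> x = Some (indicator released x)"
    unfolding generic_algorithm_def generic_description_def by auto
  show "\<not> computable_set (dom \<Phi>)"
  proof
    assume "computable_set (dom \<Phi>)"
    then have "partial_computable (\<lambda>x. Some (case \<Phi> x of None \<Rightarrow> 0 | Some y \<Rightarrow> y))"
      using \<Phi>(1) by (rule partial_computable_fill_0[rotated])
    moreover have "(case \<Phi> x of None \<Rightarrow> 0 | Some y \<Rightarrow> y) = indicator (dom \<Phi> \<inter> released) x" for x
      using \<Phi>(4)[of x] by (cases "\<Phi> x") (auto simp: indicator_def domIff)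
    ultimately have "computable_set (dom \<Phi> \<inter> released)"
      unfolding computable_set_def by simp
    then have "\<not> has_density (dom \<Phi> \<inter> released) 1"
      by (rule released_no_computable_dense_subset) simp
    then show False
      using has_density_1_Int[OF \<Phi>(3) has_density_released] by blast
  qed
qed

end
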